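(* Let $W$ be a weight function as in the context. When $\log Q\ll\log N$, for every sequence of complex numbers $(\varphi_n)_{1\le n\le N}$ we have $$\sum_{q\ge1}\frac{W(q/Q)}{qQ}\sum_{a\,\mathrm{mod}^*q}|S(\varphi,a/q)|^2=(1+\mathcal{O}(N/Q))\,I_0(W)\sum_m|\varphi_m|^2 .$$
   Context: $e(x)=\exp(2\pi i x)$ and $S(\varphi,\alpha)=\sum_{1\le n\le N}\varphi_n e(n\alpha)$. The notation $a\,\mathrm{mod}^*q$ means that $a$ runs over the reduced residue classes modulo $q$; $\phi$ is Euler's totient function. The weight $W:\mathbb{R}\to\mathbb{R}$ is of class $C^3$ on $\mathbb{R}$ and piecewise $C^4$, it is even with support inside $[-2,-1]\cup[1,2]$, and $\int_0^\infty W(u)du\ne0$. One sets $I_0(W)=\sum_{q\ge1}\frac{\phi(q)W(q/Q)}{qQ}$ (this depends on $Q$). Implied constants depend only on $W$ and on the constant implied in $\log Q\ll\log N$.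
   Formalization: The formal statement requires Q ≥ Q_0(W), with Q_0 depending only on W, since W may change sign and I_0(W) can then vanish for a small Q (e.g. Q = 5/2, N = 2) while the left-hand side does not. *)

theory Defs
  imports "HOL-Analysis.Analysis" "HOL-Number_Theory.Number_Theory"
begin

definition e :: "real \<Rightarrow> complex" where
  "e x = exp (2 * of_real pi * \<i> * of_real x)"

definition S :: "nat \<Rightarrow> (nat \<Rightarrow> complex) \<Rightarrow> real \<Rightarrow> complex" where
  "S N \<phi> \<alpha> = (\<Sum>n=1..N. \<phi> n * e (real n * \<alpha>))"

text \<open>
  \<open>D j\<close> is the \<open>j\<close>-th derivative. At the endpoints of a compact interval \<open>I\<close> the
  derivatives are one-sided.
\<close>

definition Ck_on :: "nat \<Rightarrow> real set \<Rightarrow> (real \<Rightarrow> real) \<Rightarrow> bool" where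
  "Ck_on k I f \<longleftrightarrow>
     (\<exists>D :: nat \<Rightarrow> real \<Rightarrow> real.
        (\<forall>x\<in>I. D 0 x = f x) \<and>
        (\<forall>j<k. \<forall>x\<in>I. (D j has_real_derivative D (Suc j) x) (at x within I)) \<and>
        (\<forall>j\<le>k. continuous_on I (D j)))"

text \<open>
  There is a finite set \<open>P\<close> of break points such that \<open>f\<close> is $C^k$ up to the boundary on
  every closed piece; quantifying over all compact subintervals of the closed pieces also
  covers the two unbounded ones.
\<close>

definition piecewise_Ck :: "nat \<Rightarrow> (real \<Rightarrow> real) \<Rightarrow> bool" where
  "piecewise_Ck k f \<longleftrightarrow>
     (\<exists>P. finite P \<and> (\<forall>a b. a < b \<and> {a<..<b} \<inter> P = {} \<longrightarrow> Ck_on k {a..b} f))"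

definition weight :: "(real \<Rightarrow> real) \<Rightarrow> bool" where
  "weight W \<longleftrightarrow>
     Ck_on 3 UNIV W \<and> piecewise_Ck 4 W \<and>
     (\<forall>u. W (- u) = W u) \<and>
     closure {u. W u \<noteq> 0} \<subseteq> {-2..-1} \<union> {1..2} \<and>
     integral {0..} W \<noteq> 0"

text \<open>
  The terms vanish outside \<open>Q \<le> q \<le> 2 * Q\<close>, so for a weight this is a finite sum. As \<open>W\<close> may
  change sign, \<open>I0 W Q\<close> may vanish for small \<open>Q\<close>; it tends to $(6/\pi^2) \int_0^\infty W \ne 0$
  as \<open>Q\<close> tends to infinity, so a relative error term makes sense for large \<open>Q\<close>.
\<close>

definition I0 :: "(real \<Rightarrow> real) \<Rightarrow> real \<Rightarrow> real" where
  "I0 W Q = (\<Sum>\<^sub>\<infinity>q\<in>{1..}. real (totient q) * W (real q / Q) / (real q * Q))"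

end

theory Submission
  imports Defs "HOL-Computational_Algebra.Squarefree"
begin

text \<open>
  Write \<open>s\<close> for the sum of the \<open>|\<phi> m|\<^sup>2\<close>, \<open>A q\<close> for the sum of \<open>|S N \<phi> (a/q)|\<^sup>2\<close> over reduced
  residues \<open>a\<close>, and \<open>w u = W u / u\<close>. Then the left-hand side is \<open>Q\<^sup>-\<^sup>2\<close> times the sum of
  \<open>A q * w (q/Q)\<close>, and \<open>I0 W Q * s\<close> is the same expression with \<open>totient q * s\<close> in place of
  \<open>A q\<close>. It is therefore enough to study the difference \<open>c q = A q - totient q * s\<close>.

  Everything rests on one exact fact: sorting the fractions \<open>a/r\<close> by their reduced
  denominators, the sum of \<open>A q\<close> over \<open>q dvd r\<close> is the sum of \<open>|S N \<phi> (a/r)|\<^sup>2\<close> over all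
  \<open>a\<close> modulo \<open>r\<close>, and for \<open>r \<ge> N\<close> orthogonality of characters makes this \<open>r * s\<close>
  (\<open>sum_fractions_reduced\<close>, \<open>sum_S_complete\<close>). So the divisor sums of \<open>c\<close> vanish from \<open>N\<close> on.

  This is used twice. Averaging the identity over \<open>r\<close> in \<open>[N, 2N)\<close>, where each \<open>q \<le> N\<close> has
  at least \<open>N / (2q)\<close> multiples, gives a large sieve inequality on average: the sum of
  \<open>A q / q\<close> over \<open>q \<le> N\<close> is at most \<open>4 N s\<close> (\<open>sum_over_modulus_le\<close>). On the other hand,
  Moebius inversion writes \<open>w (q/Q)\<close> as the sum of \<open>h (q m)\<close> over \<open>m\<close>, where \<open>h r\<close> is the sum
  of \<open>\<mu>(d) w (d r/Q)\<close> over \<open>d\<close>. Hence the sum of \<open>c q * w (q/Q)\<close> is the sum over \<open>r\<close> of \<open>h r\<close>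
  times the divisor sum of \<open>c\<close> at \<open>r\<close>; only \<open>r < N\<close> contributes, and regrouping by \<open>q\<close> gives
  the sum over \<open>q < N\<close> of \<open>c q\<close> times a truncation of the sum of the \<open>h (q m)\<close>
  (\<open>sum_weighted_bound\<close>).

  The point is that this truncation is \<open>O(Q/q)\<close> uniformly, without a logarithm
  (\<open>moebius_truncated\<close>). The complete sum is \<open>w (q/Q)\<close>, and in the complementary sum over
  \<open>m \<ge> M\<close> the inner sum over \<open>m\<close> is a Riemann sum for the integral of \<open>w\<close>. The errors add up to
  \<open>O(Q/q)\<close>, and the main terms form the sum of \<open>(\<mu>(d)/d) * F(\<eta> d)\<close> with \<open>F\<close> of bounded
  variation, which partial summation bounds because the sums of \<open>\<mu>(d)/d\<close> lie in \<open>[-1, 1]\<close>.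

  Altogether the difference is \<open>O(N/Q) * s\<close>. To express it relative to \<open>I0 W Q\<close>, the same
  Riemann sums show that \<open>I0 W Q\<close> is \<open>\<integral>\<^sub>0\<^sup>\<infinity> W\<close> times a partial sum of \<open>\<mu>(d)/d\<^sup>2\<close>, up to
  \<open>O(1/\<surd>Q)\<close>; that partial sum is at least \<open>1/4\<close>, so \<open>|I0 W Q|\<close> is bounded below for large \<open>Q\<close>
  (\<open>I0_lower_bound\<close>).
\<close>

section \<open>The Moebius function\<close>

definition moebius :: "nat \<Rightarrow> real" where
  "moebius n = (if squarefree n then (- 1) ^ card (prime_factors n) else 0)"

lemma abs_moebius_le_1: "\<bar>moebius n\<bar> \<le> 1"
  by (simp add: moebius_def power_abs)

lemma moebius_1 [simp]: "moebius (Suc 0) = 1"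
  by (simp add: moebius_def)

lemma moebius_prime_mult:
  assumes "prime p" "\<not> p dvd d" "squarefree d"
  shows "moebius (p * d) = - moebius d"
proof -
  have d0: "d \<noteq> 0" using assms(2) by (metis dvd_0_right)
  have cop: "coprime p d" using assms by (simp add: prime_imp_coprime)
  have "squarefree (p * d)"
    using cop assms by (intro squarefree_mult_coprime) (auto intro: squarefree_prime)
  moreover have "prime_factors (p * d) = insert p (prime_factors d)"
    using assms(1) d0 prime_factors_product[of p d] by (simp add: prime_prime_factors)
  moreover have "p \<notin> prime_factors d" using assms(2) by (auto dest: in_prime_factors_imp_dvd)
  ultimately show ?thesis using assms by (simp add: moebius_def)
qed

text \<open>
  For a prime \<open>p\<close> dividing \<open>n\<close>, multiplication by \<open>p\<close> matches the squarefree divisors prime to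
  \<open>p\<close> with those divisible by \<open>p\<close>, and it reverses the sign.
\<close>

lemma sum_moebius_divisors:
  assumes "n > 0"
  shows "(\<Sum>d | d dvd n. moebius d) = (if n = 1 then 1 else 0)"
proof (cases "n = 1")
  case False
  obtain p where p: "prime p" "p dvd n" using False by (metis prime_factor_nat)
  define D where "D = {d. d dvd n \<and> squarefree d}"
  have fin: "finite {d. d dvd n}" using assms by simp
  have finD: "finite D" unfolding D_def by (rule finite_subset[OF _ fin]) auto
  have "(\<Sum>d | d dvd n. moebius d) = sum moebius D"
    by (rule sum.mono_neutral_right[OF fin]) (auto simp: D_def moebius_def)
  also have "D = {d\<in>D. \<not> p dvd d} \<union> {d\<in>D. p dvd d}" by auto
  also have "sum moebius \<dots> = sum moebius {d\<in>D. \<not> p dvd d} + sum moebius {d\<in>D. p dvd d}"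
    by (rule sum.union_disjoint) (use finD in auto)
  also have "sum moebius {d\<in>D. p dvd d} = (\<Sum>d | d \<in> D \<and> \<not> p dvd d. moebius (p * d))"
  proof (rule sum.reindex_bij_witness[of _ "\<lambda>d. p * d" "\<lambda>d. d div p"])
    fix d assume d: "d \<in> {d\<in>D. p dvd d}"
    then obtain c where c: "d = p * c" by auto
    have p0: "p > 0" using p(1) prime_gt_0_nat by auto
    have sq: "squarefree (p * c)" and dv: "p * c dvd n" using d c by (auto simp: D_def)
    have np: "\<not> p dvd c"
    proof
      assume "p dvd c"
      then have "p ^ 2 dvd p * c" by (simp add: power2_eq_square)
      then have "p dvd 1" using sq squarefreeD by blast
      then show False using p(1) by auto
    qed
    show "p * (d div p) = d" using c p0 by simp
    show "d div p \<in> {d \<in> D. \<not> p dvd d}"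
      using c p0 np sq dv squarefree_multD(2) dvd_mult_right by (auto simp: D_def)
    show "moebius (p * (d div p)) = moebius d" using c p0 by simp
  next
    fix d assume d: "d \<in> {d\<in>D. \<not> p dvd d}"
    have p0: "p > 0" using p(1) prime_gt_0_nat by auto
    have cop: "coprime p d" using d p by (simp add: prime_imp_coprime)
    show "p * d div p = d" using p0 by simp
    show "p * d \<in> {d \<in> D. p dvd d}"
      using d p cop by (auto simp: D_def intro!: squarefree_mult_coprime divides_mult intro: squarefree_prime)
  qed
  also have "\<dots> = (\<Sum>d | d \<in> D \<and> \<not> p dvd d. - moebius d)"
    by (rule sum.cong) (use p in \<open>auto simp: D_def intro!: moebius_prime_mult\<close>)
  finally show ?thesis using False by (simp add: sum_negf)
qed simp

text \<open>
  The hyperbola rearrangement \<open>n = i * j\<close>; the hypothesis cuts the square of pairs down to the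
  region under the hyperbola.
\<close>

lemma sum_divisor_pairs:
  fixes G :: "nat \<Rightarrow> nat \<Rightarrow> real"
  assumes "\<And>i j. i * j > X \<Longrightarrow> G i j = 0"
  shows "(\<Sum>i=1..X. \<Sum>j=1..X. G i j) = (\<Sum>n=1..X. \<Sum>i | i dvd n. G i (n div i))"
proof -
  define P where "P = {(i, j). i \<ge> 1 \<and> j \<ge> 1 \<and> i * j \<le> X}"
  have Psub: "P \<subseteq> {1..X} \<times> {1..X}"
  proof
    fix x assume "x \<in> P"
    then obtain i j where x: "x = (i, j)" "i \<ge> 1" "j \<ge> 1" "i * j \<le> X" by (auto simp: P_def)
    have "i * 1 \<le> i * j" "1 * j \<le> i * j" using x by (intro mult_le_mono; simp)+
    then have "i \<le> X" "j \<le> X" using x(4) by linarith+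
    then show "x \<in> {1..X} \<times> {1..X}" using x by simp
  qed
  have "(\<Sum>i=1..X. \<Sum>j=1..X. G i j) = (\<Sum>(i,j)\<in>{1..X}\<times>{1..X}. G i j)"
    by (simp add: sum.cartesian_product)
  also have "\<dots> = (\<Sum>(i,j)\<in>P. G i j)"
    using Psub assms by (intro sum.mono_neutral_right) (auto simp: P_def not_le[symmetric])
  also have "\<dots> = (\<Sum>(n,i)\<in>(SIGMA n:{1..X}. {i. i dvd n}). G i (n div i))"
    by (rule sum.reindex_bij_witness[of _ "\<lambda>(n,i). (i, n div i)" "\<lambda>(i,j). (i * j, i)"])
       (auto simp: P_def intro!: Nat.gr0I)
  also have "\<dots> = (\<Sum>n=1..X. \<Sum>i | i dvd n. G i (n div i))"
    by (rule sum.Sigma[symmetric]) auto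
  finally show ?thesis .
qed

text \<open>
  The sum of \<open>\<mu>(d) \<lfloor>n/d\<rfloor>\<close> over \<open>d \<le> n\<close> is \<open>1\<close>. Replacing \<open>\<lfloor>n/d\<rfloor>\<close> by \<open>n/d\<close> costs at most \<open>1\<close>
  for each \<open>d < n\<close> and nothing for \<open>d = n\<close>, so \<open>n\<close> times the sum in question has absolute
  value at most \<open>1 + (n - 1)\<close>.
\<close>

lemma abs_sum_moebius_over_le_1: "\<bar>\<Sum>d=1..n. moebius d / real d\<bar> \<le> 1"
proof (cases "n = 0")
  case False
  have "(\<Sum>d=1..n. moebius d * real (n div d)) = (\<Sum>d=1..n. \<Sum>j=1..n. if d * j \<le> n then moebius d else 0)"
  proof (rule sum.cong[OF refl])
    fix d assume d: "d \<in> {1..n}"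
    have "(\<Sum>j=1..n. if d * j \<le> n then moebius d else 0) = (\<Sum>j\<in>{j\<in>{1..n}. d * j \<le> n}. moebius d)"
      by (simp add: sum.If_cases Int_def)
    also have "{j\<in>{1..n}. d * j \<le> n} = {1..n div d}"
    proof -
      have "j \<le> n div d \<longleftrightarrow> d * j \<le> n" for j
        using d less_eq_div_iff_mult_less_eq[of d j n] by (simp add: mult.commute)
      moreover have "j \<le> n" if "d * j \<le> n" for j
        using d that le_trans[of j "d * j" n] by simp
      ultimately show ?thesis by auto
    qed
    finally show "moebius d * real (n div d) = (\<Sum>j=1..n. if d * j \<le> n then moebius d else 0)" by simp
  qed
  also have "\<dots> = (\<Sum>m=1..n. \<Sum>d | d dvd m. if d * (m div d) \<le> n then moebius d else 0)"
    by (rule sum_divisor_pairs) simp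
  also have "\<dots> = (\<Sum>m=1..n. \<Sum>d | d dvd m. moebius d)"
    by (intro sum.cong refl) auto
  also have "\<dots> = (\<Sum>m=1..n. if m = 1 then 1 else 0)"
    by (intro sum.cong refl sum_moebius_divisors) auto
  also have "\<dots> = 1" using False by simp
  finally have one: "(\<Sum>d=1..n. moebius d * real (n div d)) = 1" .
  define r where "r d = real n / real d - real (n div d)" for d
  have r: "0 \<le> r d" "r d \<le> 1" for d
    unfolding r_def using floor_correct[of "real n / real d"] by (simp_all add: floor_divide_of_nat_eq)
  have rn: "r n = 0" using False by (simp add: r_def)
  have "real n * (\<Sum>d=1..n. moebius d / real d) = (\<Sum>d=1..n. moebius d * (r d + real (n div d)))"
    by (simp add: r_def sum_distrib_left mult_ac)
  also have "\<dots> = 1 + (\<Sum>d=1..n. moebius d * r d)"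
    using one by (simp add: distrib_left sum.distrib)
  finally have eq: "real n * (\<Sum>d=1..n. moebius d / real d) = 1 + (\<Sum>d=1..n. moebius d * r d)" .
  have "\<bar>\<Sum>d=1..n. moebius d * r d\<bar> \<le> (\<Sum>d=1..n. if d = n then 0 else 1)"
  proof (rule order_trans[OF sum_abs sum_mono])
    fix d assume "d \<in> {1..n}"
    have "\<bar>moebius d * r d\<bar> \<le> 1 * 1"
      unfolding abs_mult by (intro mult_mono) (use r[of d] abs_moebius_le_1[of d] in auto)
    then show "\<bar>moebius d * r d\<bar> \<le> (if d = n then 0 else 1)" using rn by auto
  qed
  also have "\<dots> = real n - 1"
  proof -
    have "{1..n} \<inter> - {n} = {1..n} - {n}" by auto
    then show ?thesis using False by (simp add: sum.If_cases of_nat_diff)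
  qed
  finally have "\<bar>real n * (\<Sum>d=1..n. moebius d / real d)\<bar> \<le> real n"
    using eq by linarith
  then show ?thesis using False by (simp add: abs_mult)
qed simp

text \<open>
  The terms \<open>d = 1, 2\<close> contribute at least \<open>3/4\<close>, and the others are bounded by the
  telescoping terms \<open>1/(d-1) - 1/d\<close>, which lose less than \<open>1/2\<close>.
\<close>

lemma sum_moebius_squares_ge:
  assumes "n \<ge> 1"
  shows "(\<Sum>d=1..n. moebius d / (real d)\<^sup>2) \<ge> 1 / 4"
proof (cases "n = 1")
  case False
  have tail: "(\<Sum>d=1..n. moebius d / (real d)\<^sup>2) \<ge> 1 / 4 + 1 / real n" if "n \<ge> 2" for n
    using that
  proof (induction n rule: dec_induct)
    case base
    have "moebius 2 \<ge> -1" using abs_moebius_le_1[of 2] by linarith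
    then show ?case by (simp add: numeral_2_eq_2)
  next
    case (step n)
    have "moebius (Suc n) / (real (Suc n))\<^sup>2 \<ge> - 1 / (real (Suc n))\<^sup>2"
      using abs_moebius_le_1[of "Suc n"] by (intro divide_right_mono) auto
    moreover have "1 / (real (Suc n))\<^sup>2 \<le> 1 / real n - 1 / real (Suc n)"
    proof -
      have "1 / real n - 1 / real (Suc n) = 1 / (real n * real (Suc n))"
        using step by (simp add: field_simps)
      also have "\<dots> \<ge> 1 / (real (Suc n))\<^sup>2"
        using step unfolding power2_eq_square by (intro divide_left_mono mult_right_mono) auto
      finally show ?thesis .
    qed
    ultimately show ?case using step.IH by simp
  qed
  then have "1 / 4 + 1 / real n \<le> (\<Sum>d=1..n. moebius d / (real d)\<^sup>2)" using assms False by simp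
  then show ?thesis using order_trans[of "1/4" "1/4 + 1 / real n"] by simp
qed simp

section \<open>Lipschitz cut-offs and their dilates\<close>

lemma continuous_antiderivative:
  fixes w :: "real \<Rightarrow> real"
  assumes "continuous_on UNIV w" "\<And>x. x \<ge> b \<Longrightarrow> w x = 0"
  shows "\<exists>F. (\<forall>x. (F has_real_derivative w x) (at x)) \<and> (\<forall>x\<ge>b. F x = 0)"
proof -
  have "isCont w x" for x using assms(1) by (simp add: continuous_on_eq_continuous_at)
  then obtain G where G: "\<And>x. (G has_vector_derivative w x) (at x)"
    using einterval_antiderivative[of "-\<infinity>" "\<infinity>" w] by auto
  have G': "(G has_real_derivative w x) (at x)" for x
    using G[of x] by (simp add: has_real_derivative_iff_has_vector_derivative)
  have const: "G x = G b" if "x \<ge> b" for x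
  proof (cases "x = b")
    case False
    then have "b < x" using that by simp
    then obtain z where "z > b" "z < x" "G x - G b = (x - b) * w z"
      using MVT2[of b x G w] G' by auto
    then show ?thesis using assms(2)[of z] by simp
  qed simp
  show ?thesis
  proof (intro exI conjI allI impI)
    show "((\<lambda>x. G x - G b) has_real_derivative w x) (at x)" for x
      using DERIV_diff[OF G'[of x] DERIV_const[of "G b"]] by simp
    show "G x - G b = 0" if "x \<ge> b" for x
      unfolding const[OF that] by simp
  qed
qed

lemma count_multiples_le:
  assumes "\<delta> > 0" "M \<ge> 1"
  shows "real (card {m\<in>{M..X}. \<delta> * real m < 2}) \<le> 2 / \<delta>"
proof -
  have "{m\<in>{M..X}. \<delta> * real m < 2} \<subseteq> {1..nat \<lfloor>2 / \<delta>\<rfloor>}"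
  proof
    fix m assume m: "m \<in> {m\<in>{M..X}. \<delta> * real m < 2}"
    then have "real m \<le> 2 / \<delta>" using assms by (simp add: field_simps)
    then have "m \<le> nat \<lfloor>2 / \<delta>\<rfloor>" by (simp add: le_nat_floor)
    then show "m \<in> {1..nat \<lfloor>2 / \<delta>\<rfloor>}" using m assms by auto
  qed
  then have "card {m\<in>{M..X}. \<delta> * real m < 2} \<le> nat \<lfloor>2 / \<delta>\<rfloor>"
    using card_mono[of "{1..nat \<lfloor>2 / \<delta>\<rfloor>}"] by fastforce
  then show ?thesis using assms by (smt (verit, best) divide_pos_pos of_nat_floor of_nat_mono)
qed

text \<open>
  Abel summation, in the form that a sequence ending at \<open>0\<close> with variation \<open>V\<close>, tested against
  coefficients with partial sums in \<open>[-1, 1]\<close>, gives at most \<open>V\<close>.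
\<close>

lemma sum_by_parts_bound:
  fixes c u :: "nat \<Rightarrow> real"
  assumes "\<And>n. \<bar>\<Sum>d=1..n. c d\<bar> \<le> 1" "u (Suc X) = 0"
  shows "\<bar>\<Sum>d=1..X. c d * u d\<bar> \<le> (\<Sum>d=1..X. \<bar>u (Suc d) - u d\<bar>)"
proof -
  have parts: "(\<Sum>d=1..X. c d * u d) = (\<Sum>d=1..X. c d) * u (Suc X) - (\<Sum>d=1..X. (\<Sum>j=1..d. c j) * (u (Suc d) - u d))" for X
    by (induction X) (auto simp: algebra_simps)
  have "\<bar>\<Sum>d=1..X. c d * u d\<bar> = \<bar>\<Sum>d=1..X. (\<Sum>j=1..d. c j) * (u (Suc d) - u d)\<bar>"
    using parts[of X] assms(2) by simp
  also have "\<dots> \<le> (\<Sum>d=1..X. 1 * \<bar>u (Suc d) - u d\<bar>)"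
    by (rule order_trans[OF sum_abs sum_mono]) (unfold abs_mult, intro mult_right_mono assms(1) abs_ge_zero)
  finally show ?thesis by simp
qed

text \<open>
  \<open>F\<close> is minus the integral of \<open>w\<close> from its argument to infinity, so \<open>- F (\<delta> M) / \<delta>\<close> is the
  main term of a sum of \<open>w (\<delta> m)\<close> over \<open>m \<ge> M\<close>.
\<close>

locale lipschitz_cutoff =
  fixes w F :: "real \<Rightarrow> real" and k :: real
  assumes lip: "\<bar>w x - w y\<bar> \<le> k * \<bar>x - y\<bar>"
    and beyond: "x \<ge> 2 \<Longrightarrow> w x = 0"
    and deriv: "(F has_real_derivative w x) (at x)"
    and F_beyond: "x \<ge> 2 \<Longrightarrow> F x = 0"
begin

lemma k_nonneg: "0 \<le> k"
  using lip[of 0 1] by simp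

lemma w_bound: "x \<ge> 0 \<Longrightarrow> \<bar>w x\<bar> \<le> 2 * k"
proof (cases "x \<ge> 2")
  case False
  assume "x \<ge> 0"
  have "\<bar>w x\<bar> \<le> k * \<bar>x - 2\<bar>" using lip[of x 2] beyond[of 2] by simp
  also have "\<dots> \<le> k * 2" using False \<open>x \<ge> 0\<close> k_nonneg by (intro mult_left_mono) auto
  finally show ?thesis by simp
qed (simp add: beyond k_nonneg)

lemma F_mvt:
  assumes "x < y"
  obtains z where "x < z" "z < y" "F y - F x = (y - x) * w z"
  using MVT2[OF assms, of F w] deriv by auto

lemma F_lipschitz:
  assumes "0 \<le> x" "x \<le> y"
  shows "\<bar>F y - F x\<bar> \<le> 2 * k * (y - x)"
proof (cases "x = y")
  case False
  then obtain z where z: "x < z" "z < y" "F y - F x = (y - x) * w z"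
    using F_mvt[of x y] assms by auto
  have "\<bar>F y - F x\<bar> = (y - x) * \<bar>w z\<bar>" using z by (simp add: abs_mult)
  also have "\<dots> \<le> (y - x) * (2 * k)" using z assms w_bound[of z] by (intro mult_left_mono) auto
  finally show ?thesis by (simp add: mult_ac)
qed simp

text \<open>
  Each step of length \<open>\<delta>\<close> contributes an error \<open>k * \<delta>\<close> by the mean value theorem. At most
  \<open>2/\<delta>\<close> steps start below \<open>2\<close>, where \<open>w\<close> ends, so the total error does not depend on \<open>\<delta>\<close>.
\<close>

lemma riemann_sum:
  assumes "\<delta> > 0" "M \<ge> 1" "\<delta> * real X \<ge> 2"
  shows "\<bar>(\<Sum>m=M..X. w (\<delta> * real m)) + F (\<delta> * real M) / \<delta>\<bar> \<le> 2 * k"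
proof (cases "M \<le> X")
  case True
  define a where "a m = w (\<delta> * real m) - (F (\<delta> * real (Suc m)) - F (\<delta> * real m)) / \<delta>" for m
  have a0: "a m = 0" if "\<not> \<delta> * real m < 2" for m
  proof -
    have "\<delta> * real (Suc m) \<ge> 2" using that assms(1) by (simp add: distrib_left)
    then show ?thesis using that by (simp add: a_def beyond F_beyond)
  qed
  have a1: "\<bar>a m\<bar> \<le> k * \<delta>" for m
  proof -
    obtain z where z: "\<delta> * real m < z" "z < \<delta> * real (Suc m)"
      "F (\<delta> * real (Suc m)) - F (\<delta> * real m) = (\<delta> * real (Suc m) - \<delta> * real m) * w z"
      using F_mvt[of "\<delta> * real m" "\<delta> * real (Suc m)"] assms(1) by auto
    have "\<delta> * real (Suc m) - \<delta> * real m = \<delta>" by (simp add: algebra_simps)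
    then have "a m = w (\<delta> * real m) - w z" using z assms(1) by (simp add: a_def)
    also have "\<bar>\<dots>\<bar> \<le> k * \<bar>\<delta> * real m - z\<bar>" by (rule lip)
    also have "\<dots> \<le> k * \<delta>"
      using z k_nonneg by (intro mult_left_mono) (auto simp: algebra_simps)
    finally show ?thesis .
  qed
  have "(\<Sum>m=M..X. a m) = (\<Sum>m=M..X. w (\<delta> * real m))
      - (\<Sum>m=M..X. F (\<delta> * real (Suc m)) - F (\<delta> * real m)) / \<delta>"
    by (simp add: a_def sum_subtractf sum_divide_distrib diff_divide_distrib)
  also have "(\<Sum>m=M..X. F (\<delta> * real (Suc m)) - F (\<delta> * real m)) = F (\<delta> * real (Suc X)) - F (\<delta> * real M)"
    using sum_Suc_diff[of M X "\<lambda>m. F (\<delta> * real m)"] True by simp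
  also have "F (\<delta> * real (Suc X)) = 0"
    using assms by (intro F_beyond) (simp add: distrib_left)
  finally have "(\<Sum>m=M..X. w (\<delta> * real m)) + F (\<delta> * real M) / \<delta> = (\<Sum>m=M..X. a m)" by simp
  also have "\<dots> = (\<Sum>m\<in>{m\<in>{M..X}. \<delta> * real m < 2}. a m)"
    by (rule sum.mono_neutral_right) (use a0 in auto)
  also have "\<bar>\<dots>\<bar> \<le> real (card {m\<in>{M..X}. \<delta> * real m < 2}) * (k * \<delta>)"
    using sum_norm_bound[of "{m\<in>{M..X}. \<delta> * real m < 2}" a "k * \<delta>"] a1 by simp
  also have "\<dots> \<le> 2 / \<delta> * (k * \<delta>)"
    using assms k_nonneg by (intro mult_right_mono count_multiples_le) auto
  also have "\<dots> = 2 * k" using assms by simp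
  finally show ?thesis .
next
  case False
  then have "\<delta> * real X \<le> \<delta> * real M" using assms by (intro mult_left_mono) auto
  then have "F (\<delta> * real M) = 0" using assms by (intro F_beyond) linarith
  then show ?thesis using False k_nonneg by simp
qed

text \<open>
  The sampled function \<open>F (\<eta> d)\<close> has variation at most \<open>4 * k\<close> whatever the mesh \<open>\<eta>\<close>: at most
  \<open>2/\<eta>\<close> increments are nonzero, each at most \<open>2 * k * \<eta>\<close>. This uniformity is what prevents a
  logarithm in \<open>moebius_tail\<close>.
\<close>

lemma moebius_F_sum:
  assumes "\<eta> > 0" "\<eta> * real (Suc X) \<ge> 2"
  shows "\<bar>\<Sum>d=1..X. moebius d / real d * F (\<eta> * real d)\<bar> \<le> 4 * k"
proof -
  define u where "u d = F (\<eta> * real d)" for d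
  have "u (Suc X) = 0" using assms by (simp add: u_def F_beyond)
  then have "\<bar>\<Sum>d=1..X. moebius d / real d * u d\<bar> \<le> (\<Sum>d=1..X. \<bar>u (Suc d) - u d\<bar>)"
    by (intro sum_by_parts_bound abs_sum_moebius_over_le_1)
  also have "\<dots> = (\<Sum>d\<in>{d\<in>{1..X}. \<eta> * real d < 2}. \<bar>u (Suc d) - u d\<bar>)"
  proof (rule sum.mono_neutral_right)
    show "\<forall>i\<in>{1..X} - {d \<in> {1..X}. \<eta> * real d < 2}. \<bar>u (Suc i) - u i\<bar> = 0"
    proof
      fix i assume "i \<in> {1..X} - {d \<in> {1..X}. \<eta> * real d < 2}"
      then have "\<eta> * real i \<ge> 2" "\<eta> * real (Suc i) \<ge> 2"
        using assms(1) by (auto simp: distrib_left)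
      then show "\<bar>u (Suc i) - u i\<bar> = 0" by (simp add: u_def F_beyond)
    qed
  qed auto
  also have "\<dots> \<le> real (card {d\<in>{1..X}. \<eta> * real d < 2}) * (2 * k * \<eta>)"
  proof (rule sum_bounded_above)
    fix d
    have "\<bar>F (\<eta> * real (Suc d)) - F (\<eta> * real d)\<bar> \<le> 2 * k * (\<eta> * real (Suc d) - \<eta> * real d)"
      using assms by (intro F_lipschitz) (auto intro!: mult_left_mono)
    then show "\<bar>u (Suc d) - u d\<bar> \<le> 2 * k * \<eta>" by (simp add: u_def algebra_simps)
  qed
  also have "\<dots> \<le> 2 / \<eta> * (2 * k * \<eta>)"
    using assms k_nonneg by (intro mult_right_mono count_multiples_le) auto
  also have "\<dots> = 4 * k" using assms by simp
  finally show ?thesis by (simp add: u_def)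
qed

text \<open>
  For fixed \<open>d\<close> the sum over \<open>m\<close> is a Riemann sum with mesh \<open>d/Y\<close>. There are at most \<open>2 * Y\<close>
  relevant \<open>d\<close>, so the bounded errors \<open>R d\<close> add up to \<open>O(Y)\<close>, while the main terms are
  \<open>-Y\<close> times the sum bounded in \<open>moebius_F_sum\<close>.
\<close>

lemma moebius_tail:
  assumes "Y > 0" "real X \<ge> 2 * Y" "M \<ge> 1"
  shows "\<bar>\<Sum>m=M..X. \<Sum>d=1..X. moebius d * w (real d * real m / Y)\<bar> \<le> 8 * k * Y"
proof -
  define R where "R d = (\<Sum>m=M..X. w (real d / Y * real m)) + F (real d / Y * real M) / (real d / Y)" for d
  have R0: "R d = 0" if "\<not> 1 / Y * real d < 2" for d
  proof -
    have d2: "real d / Y * real m \<ge> 2" if "m \<ge> 1" for m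
    proof -
      have "2 * 1 \<le> real d / Y * real m"
        using that \<open>\<not> 1 / Y * real d < 2\<close> assms by (intro mult_mono) auto
      then show ?thesis by simp
    qed
    have "w (real d / Y * real m) = 0" if "m \<in> {M..X}" for m
      using d2[of m] that assms(3) by (intro beyond) auto
    moreover have "F (real d / Y * real M) = 0" using d2[of M] assms by (intro F_beyond)
    ultimately show ?thesis by (simp add: R_def)
  qed
  have R1: "\<bar>R d\<bar> \<le> 2 * k" if "d \<ge> 1" for d
  proof -
    have "real d / Y * real X \<ge> 2"
    proof -
      have "1 * (2 * Y) \<le> real d * real X" using that assms by (intro mult_mono) auto
      then show ?thesis using assms by (simp add: field_simps)
    qed
    then show ?thesis unfolding R_def using that assms by (intro riemann_sum) auto
  qed
  have "(\<Sum>m=M..X. \<Sum>d=1..X. moebius d * w (real d * real m / Y))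
      = (\<Sum>d=1..X. moebius d * (\<Sum>m=M..X. w (real d / Y * real m)))"
    by (subst sum.swap) (simp add: sum_distrib_left)
  also have "\<dots> = (\<Sum>d=1..X. moebius d * R d - Y * (moebius d / real d * F (real M / Y * real d)))"
    by (intro sum.cong refl) (use assms in \<open>simp add: R_def field_simps\<close>)
  also have "\<dots> = (\<Sum>d=1..X. moebius d * R d) - Y * (\<Sum>d=1..X. moebius d / real d * F (real M / Y * real d))"
    by (simp add: sum_subtractf sum_distrib_left)
  finally have eq: "(\<Sum>m=M..X. \<Sum>d=1..X. moebius d * w (real d * real m / Y)) = \<dots>" .
  have "(\<Sum>d=1..X. moebius d * R d) = (\<Sum>d\<in>{d\<in>{1..X}. 1 / Y * real d < 2}. moebius d * R d)"
    by (rule sum.mono_neutral_right) (use R0 in auto)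
  also have "\<bar>\<dots>\<bar> \<le> real (card {d\<in>{1..X}. 1 / Y * real d < 2}) * (2 * k)"
  proof -
    have "\<bar>moebius d * R d\<bar> \<le> 1 * (2 * k)" if "d \<ge> 1" for d
      unfolding abs_mult by (intro mult_mono) (use R1[OF that] abs_moebius_le_1[of d] in auto)
    then show ?thesis
      using sum_norm_bound[of "{d\<in>{1..X}. 1 / Y * real d < 2}" "\<lambda>d. moebius d * R d" "2 * k"] by simp
  qed
  also have "\<dots> \<le> 2 / (1 / Y) * (2 * k)"
    using assms k_nonneg by (intro mult_right_mono count_multiples_le) auto
  finally have b1: "\<bar>\<Sum>d=1..X. moebius d * R d\<bar> \<le> 4 * k * Y" by (simp add: mult_ac)
  have "real M / Y * real (Suc X) \<ge> 2"
  proof -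
    have "1 * (2 * Y) \<le> real M * real (Suc X)" using assms by (intro mult_mono) auto
    then show ?thesis using assms by (simp add: field_simps)
  qed
  then have "\<bar>\<Sum>d=1..X. moebius d / real d * F (real M / Y * real d)\<bar> \<le> 4 * k"
    using assms by (intro moebius_F_sum) auto
  then have "\<bar>Y * (\<Sum>d=1..X. moebius d / real d * F (real M / Y * real d))\<bar> \<le> Y * (4 * k)"
    using assms unfolding abs_mult by (intro mult_mono) auto
  then show ?thesis using b1 eq by (simp add: mult_ac)
qed

text \<open>
  Grouping by \<open>n = d * m\<close>, the Moebius sum over the divisors of \<open>n\<close> leaves only \<open>n = 1\<close>.
\<close>

lemma moebius_complete:
  assumes "Y > 0" "real X \<ge> 2 * Y"
  shows "(\<Sum>m=1..X. \<Sum>d=1..X. moebius d * w (real d * real m / Y)) = w (1 / Y)"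
proof -
  have "(\<Sum>m=1..X. \<Sum>d=1..X. moebius d * w (real d * real m / Y))
      = (\<Sum>d=1..X. \<Sum>m=1..X. moebius d * w (real (d * m) / Y))"
    by (subst sum.swap) simp
  also have "\<dots> = (\<Sum>n=1..X. \<Sum>d | d dvd n. moebius d * w (real (d * (n div d)) / Y))"
  proof (rule sum_divisor_pairs)
    fix i j :: nat assume "i * j > X"
    then have "real (i * j) \<ge> 2 * Y" using assms by linarith
    then have "w (real (i * j) / Y) = 0" using assms by (intro beyond) (simp add: field_simps)
    then show "moebius i * w (real (i * j) / Y) = 0" by simp
  qed
  also have "\<dots> = (\<Sum>n=1..X. (\<Sum>d | d dvd n. moebius d) * w (real n / Y))"
    unfolding sum_distrib_right by (intro sum.cong refl) auto
  also have "\<dots> = (\<Sum>n=1..X. if n = 1 then w (1 / Y) else 0)"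
    by (intro sum.cong refl) (auto simp: sum_moebius_divisors)
  also have "\<dots> = w (1 / Y)"
  proof (cases "X = 0")
    case True
    then have False using assms by auto
    then show ?thesis ..
  qed simp
  finally show ?thesis .
qed

text \<open>
  Bounding the truncated sum term by term would cost a logarithm; it is treated instead as
  the difference of the complete sum and its tail.
\<close>

lemma moebius_truncated:
  assumes "Y > 0" "real X \<ge> 2 * Y" "M \<ge> 1"
  shows "\<bar>\<Sum>m\<in>{m\<in>{1..X}. m < M}. \<Sum>d=1..X. moebius d * w (real d * real m / Y)\<bar> \<le> 12 * k * Y"
proof -
  define h where "h m = (\<Sum>d=1..X. moebius d * w (real d * real m / Y))" for m
  have "sum h {1..X} = sum h ({m\<in>{1..X}. m < M} \<union> {M..X})"
    using assms by (intro sum.cong refl) auto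
  also have "\<dots> = sum h {m\<in>{1..X}. m < M} + sum h {M..X}"
    by (rule sum.union_disjoint) auto
  finally have "sum h {m\<in>{1..X}. m < M} = w (1 / Y) - sum h {M..X}"
    using moebius_complete[OF assms(1,2)] by (simp add: h_def)
  moreover have "\<bar>sum h {M..X}\<bar> \<le> 8 * k * Y"
    using moebius_tail[OF assms] by (simp add: h_def)
  moreover have "\<bar>w (1 / Y)\<bar> \<le> 4 * k * Y"
  proof (cases "Y \<ge> 1 / 2")
    case True
    have "\<bar>w (1 / Y)\<bar> \<le> 2 * k" using assms by (intro w_bound) auto
    also have "\<dots> = 4 * k * (1 / 2)" by simp
    also have "\<dots> \<le> 4 * k * Y" using True k_nonneg by (intro mult_left_mono) auto
    finally show ?thesis .
  next
    case False
    then have "w (1 / Y) = 0" using assms by (intro beyond) (auto simp: field_simps)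
    then show ?thesis using assms k_nonneg by simp
  qed
  ultimately show ?thesis by (simp add: h_def)
qed

end

section \<open>Weighted sums over moduli\<close>

lemma (in lipschitz_cutoff) moebius_complete_scaled:
  assumes "Q > 0" "real X \<ge> 2 * Q" "q \<ge> 1"
  shows "w (real q / Q) = (\<Sum>m=1..X. \<Sum>d=1..X. moebius d * w (real d * real (q * m) / Q))"
proof -
  have "Q / real q \<le> Q" using assms by (simp add: field_simps)
  then have "real X \<ge> 2 * (Q / real q)" using assms by linarith
  then show ?thesis using moebius_complete[of "Q / real q" X] assms by (simp add: mult_ac)
qed

lemma (in lipschitz_cutoff) moebius_beyond:
  assumes "Q > 0" "real X \<ge> 2 * Q" "r > X"
  shows "(\<Sum>d=1..X. moebius d * w (real d * real r / Q)) = 0"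
proof -
  have "w (real d * real r / Q) = 0" if "d \<ge> 1" for d
  proof -
    have "1 * real X \<le> real d * real r" using that \<open>r > X\<close> by (intro mult_mono) auto
    then show ?thesis using assms by (intro beyond) (simp add: field_simps)
  qed
  then show ?thesis by simp
qed

text \<open>
  Duality between a sequence and its divisor sums: the weight \<open>w (q/Q)\<close> is itself the sum over
  the multiples \<open>r\<close> of \<open>q\<close> of the function \<open>h r\<close> given by the inner Moebius sum.
\<close>

lemma (in lipschitz_cutoff) sum_weighted_dual:
  fixes a :: "nat \<Rightarrow> real"
  assumes "Q > 0" "real X \<ge> 2 * Q"
  shows "(\<Sum>q=1..X. a q * w (real q / Q))
    = (\<Sum>r=1..X. (\<Sum>q | q dvd r. a q) * (\<Sum>d=1..X. moebius d * w (real d * real r / Q)))"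
proof -
  define h where "h r = (\<Sum>d=1..X. moebius d * w (real d * real r / Q))" for r
  have "(\<Sum>q=1..X. a q * w (real q / Q)) = (\<Sum>q=1..X. \<Sum>m=1..X. a q * h (q * m))"
  proof (rule sum.cong[OF refl])
    fix q assume "q \<in> {1..X}"
    then have "w (real q / Q) = (\<Sum>m=1..X. h (q * m))"
      unfolding h_def using assms by (intro moebius_complete_scaled) auto
    then show "a q * w (real q / Q) = (\<Sum>m=1..X. a q * h (q * m))" by (simp add: sum_distrib_left)
  qed
  also have "\<dots> = (\<Sum>r=1..X. \<Sum>q | q dvd r. a q * h (q * (r div q)))"
    by (rule sum_divisor_pairs) (simp only: h_def moebius_beyond[OF assms] mult_zero_right)
  also have "\<dots> = (\<Sum>r=1..X. (\<Sum>q | q dvd r. a q) * h r)"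
    unfolding sum_distrib_right by (intro sum.cong refl) auto
  finally show ?thesis by (simp add: h_def)
qed

text \<open>
  By duality only \<open>r < N\<close> contribute. Going back from divisor sums to \<open>a\<close> turns the restriction
  \<open>r < N\<close> into a truncation of the sum over the multiples of \<open>q\<close>, and \<open>moebius_truncated\<close>
  applies with \<open>Y = Q/q\<close>.
\<close>

lemma (in lipschitz_cutoff) sum_weighted_bound:
  fixes a :: "nat \<Rightarrow> real"
  assumes "Q > 0" "real X \<ge> 2 * Q" "N \<ge> 1"
    and vanish: "\<And>r. r \<ge> N \<Longrightarrow> (\<Sum>q | q dvd r. a q) = 0"
  shows "\<bar>\<Sum>q=1..X. a q * w (real q / Q)\<bar> \<le> 12 * k * Q * (\<Sum>q=1..N. \<bar>a q\<bar> / real q)"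
proof -
  define h where "h r = (\<Sum>d=1..X. moebius d * w (real d * real r / Q))" for r
  define T where "T q = (\<Sum>m\<in>{m\<in>{1..X}. q * m < N}. h (q * m))" for q
  have h0: "h r = 0" if "r > X" for r
    unfolding h_def by (rule moebius_beyond[OF assms(1,2) that])
  have Yq: "Q / real q > 0" "real X \<ge> 2 * (Q / real q)" if "q \<ge> 1" for q
  proof -
    show "Q / real q > 0" using that assms by simp
    have "Q / real q \<le> Q" using that assms by (simp add: field_simps)
    then show "real X \<ge> 2 * (Q / real q)" using assms by linarith
  qed
  have hY: "(\<Sum>d=1..X. moebius d * w (real d * real m / (Q / real q))) = h (q * m)" for q m
    by (simp add: h_def mult_ac)
  have "(\<Sum>q=1..X. a q * w (real q / Q)) = (\<Sum>r=1..X. (\<Sum>q | q dvd r. a q) * h r)"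
    unfolding h_def by (rule sum_weighted_dual[OF assms(1,2)])
  also have "\<dots> = (\<Sum>r=1..X. \<Sum>q | q dvd r. if q * (r div q) < N then a q * h (q * (r div q)) else 0)"
  proof (rule sum.cong[OF refl])
    fix r
    have "(\<Sum>q | q dvd r. a q) * h r = (if r < N then (\<Sum>q | q dvd r. a q) * h r else 0)"
      using vanish[of r] by auto
    also have "\<dots> = (\<Sum>q | q dvd r. if r < N then a q * h r else 0)"
      by (simp add: sum_distrib_right)
    also have "\<dots> = (\<Sum>q | q dvd r. if q * (r div q) < N then a q * h (q * (r div q)) else 0)"
      by (intro sum.cong refl) auto
    finally show "(\<Sum>q | q dvd r. a q) * h r = \<dots>" .
  qed
  also have "\<dots> = (\<Sum>q=1..X. \<Sum>m=1..X. if q * m < N then a q * h (q * m) else 0)"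
    by (rule sum_divisor_pairs[symmetric]) (simp add: h0)
  also have "\<dots> = (\<Sum>q=1..X. a q * T q)"
    by (intro sum.cong refl) (simp add: T_def sum_distrib_left sum.If_cases Int_def)
  finally have eq: "(\<Sum>q=1..X. a q * w (real q / Q)) = (\<Sum>q=1..X. a q * T q)" .
  have T0: "T q = 0" if "q > N" for q
  proof -
    have "\<not> q * m < N" if "m \<ge> 1" for m
      using \<open>q > N\<close> mult_le_mono[OF le_refl that, of q] by linarith
    then have "{m\<in>{1..X}. q * m < N} = {}" by auto
    then show ?thesis unfolding T_def by (simp only: sum.empty)
  qed
  have T1: "\<bar>T q\<bar> \<le> 12 * k * (Q / real q)" if q: "q \<ge> 1" for q
  proof -
    \<comment> \<open>the condition \<open>q * m < N\<close> has to be put into the form \<open>m < M\<close> with a natural number \<open>M\<close>\<close>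
    have "q * m < N \<longleftrightarrow> m < Suc ((N - 1) div q)" for m
      using q assms(3) less_eq_div_iff_mult_less_eq[of q m "N - 1"]
      by (auto simp: mult.commute less_Suc_eq_le)
    then have "T q = (\<Sum>m\<in>{m\<in>{1..X}. m < Suc ((N - 1) div q)}. h (q * m))" by (simp add: T_def)
    then show ?thesis
      using moebius_truncated[OF Yq[OF q], of "Suc ((N - 1) div q)"] unfolding hY by simp
  qed
  have aT: "\<bar>a q * T q\<bar> \<le> 12 * k * Q * (\<bar>a q\<bar> / real q)" if "q \<ge> 1" for q
  proof -
    have "\<bar>a q * T q\<bar> \<le> \<bar>a q\<bar> * (12 * k * (Q / real q))"
      unfolding abs_mult by (intro mult_left_mono T1 that) auto
    then show ?thesis by (simp add: mult_ac)
  qed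
  have "(\<Sum>q=1..X. a q * T q) = (\<Sum>q\<in>{1..X}\<inter>{1..N}. a q * T q)"
    by (rule sum.mono_neutral_right) (auto simp: T0)
  also have "\<bar>\<dots>\<bar> \<le> (\<Sum>q\<in>{1..X}\<inter>{1..N}. 12 * k * Q * (\<bar>a q\<bar> / real q))"
    by (rule order_trans[OF sum_abs sum_mono]) (use aT in auto)
  also have "\<dots> \<le> (\<Sum>q=1..N. 12 * k * Q * (\<bar>a q\<bar> / real q))"
    using assms k_nonneg by (intro sum_mono2) auto
  finally show ?thesis using eq by (simp add: sum_distrib_left)
qed

lemma sum_totient_divisors: "(\<Sum>q | q dvd r. real (totient q)) = real r"
  using totient_divisor_sum[of r] by (metis of_nat_sum)

lemma sum_inverse_le_sqrt: "(\<Sum>d=1..n. 1 / real d) \<le> 2 * sqrt (real n)"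
proof (induction n)
  case (Suc n)
  define a b where "a = sqrt (real n)" and "b = sqrt (real (Suc n))"
  have ab: "0 \<le> a" "a \<le> b" "0 < b" "b * b = a * a + 1" by (auto simp: a_def b_def)
  have "1 = (b - a) * (b + a)" using ab by (simp add: algebra_simps)
  also have "\<dots> \<le> (b - a) * (2 * b)" using ab by (intro mult_left_mono) auto
  finally have "1 * 1 \<le> (b - a) * (2 * b)" by simp
  then have "1 / (b * b) \<le> (b - a) * (2 * b) / (b * b)" using ab by (intro divide_right_mono) auto
  also have "\<dots> = 2 * (b - a) / b" using ab(3) by simp
  also have "\<dots> \<le> 2 * (b - a)"
  proof -
    have "1 \<le> b" by (simp add: b_def)
    then show ?thesis using ab(2) mult_left_mono[of 1 b "2 * (b - a)"] by (simp add: pos_divide_le_eq)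
  qed
  finally have "1 / real (Suc n) \<le> 2 * (b - a)" by (simp add: b_def)
  with Suc show ?case by (simp add: a_def b_def)
qed simp

text \<open>
  Duality applied to the totients, whose divisor sums are \<open>r\<close>. The factor \<open>r\<close> is absorbed into
  the function \<open>x * w x\<close>, and for each \<open>d\<close> there remains a Riemann sum of mesh \<open>d/Q\<close>
  for the integral of \<open>x * w x\<close>, which is \<open>-F1 0\<close>.
\<close>

lemma sum_totient_weighted:
  assumes "lipschitz_cutoff w F k" "lipschitz_cutoff (\<lambda>x. x * w x) F1 k1" "Q > 0" "real X \<ge> 2 * Q"
  shows "\<bar>(\<Sum>q=1..X. real (totient q) * w (real q / Q)) + Q\<^sup>2 * F1 0 * (\<Sum>d=1..X. moebius d / (real d)\<^sup>2)\<bar>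
    \<le> 4 * k1 * Q * (\<Sum>d=1..X. 1 / real d)"
proof -
  interpret w: lipschitz_cutoff w F k by fact
  interpret W: lipschitz_cutoff "\<lambda>x. x * w x" F1 k1 by fact
  define R where "R d = (\<Sum>r=1..X. real d / Q * real r * w (real d / Q * real r)) + F1 0 / (real d / Q)" for d
  have R: "\<bar>R d\<bar> \<le> 4 * k1" if "d \<ge> 1" for d
  proof -
    let ?\<delta> = "real d / Q"
    have "1 * (2 * Q) \<le> real d * real X" using that assms(3,4) by (intro mult_mono) auto
    then have "?\<delta> * real X \<ge> 2" using assms(3) by (simp add: field_simps)
    then have "\<bar>(\<Sum>r=1..X. ?\<delta> * real r * w (?\<delta> * real r)) + F1 ?\<delta> / ?\<delta>\<bar> \<le> 2 * k1"
      using W.riemann_sum[of ?\<delta> 1 X] that assms(3) by simp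
    moreover have "\<bar>(F1 ?\<delta> - F1 0) / ?\<delta>\<bar> \<le> 2 * k1"
    proof -
      have "\<bar>F1 ?\<delta> - F1 0\<bar> \<le> 2 * k1 * (?\<delta> - 0)" using assms(3) by (intro W.F_lipschitz) auto
      moreover have \<delta>: "?\<delta> > 0" using that assms(3) by simp
      ultimately show ?thesis
        unfolding abs_divide[of "F1 ?\<delta> - F1 0" ?\<delta>] abs_of_pos[OF \<delta>] pos_divide_le_eq[OF \<delta>] by simp
    qed
    moreover have "R d = ((\<Sum>r=1..X. ?\<delta> * real r * w (?\<delta> * real r)) + F1 ?\<delta> / ?\<delta>) - (F1 ?\<delta> - F1 0) / ?\<delta>"
      unfolding R_def diff_divide_distrib by linarith
    ultimately show ?thesis by linarith
  qed
  have "(\<Sum>q=1..X. real (totient q) * w (real q / Q))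
      = (\<Sum>r=1..X. real r * (\<Sum>d=1..X. moebius d * w (real d * real r / Q)))"
    using w.sum_weighted_dual[OF assms(3,4), of "\<lambda>q. real (totient q)"] by (simp add: sum_totient_divisors)
  also have "\<dots> = (\<Sum>d=1..X. \<Sum>r=1..X. real r * (moebius d * w (real d * real r / Q)))"
    unfolding sum_distrib_left by (rule sum.swap)
  also have "\<dots> = (\<Sum>d=1..X. Q * (moebius d / real d) * R d - Q\<^sup>2 * F1 0 * (moebius d / (real d)\<^sup>2))"
  proof (rule sum.cong[OF refl])
    fix d assume d: "d \<in> {1..X}"
    have "Q * (moebius d / real d) * (\<Sum>r=1..X. real d / Q * real r * w (real d / Q * real r))
        = (\<Sum>r=1..X. real r * (moebius d * w (real d * real r / Q)))"
      unfolding sum_distrib_left using d assms(3) by (intro sum.cong refl) simp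
    moreover have "Q * (moebius d / real d) * (F1 0 / (real d / Q)) = Q\<^sup>2 * F1 0 * (moebius d / (real d)\<^sup>2)"
      by (simp add: power2_eq_square)
    ultimately show "(\<Sum>r=1..X. real r * (moebius d * w (real d * real r / Q)))
        = Q * (moebius d / real d) * R d - Q\<^sup>2 * F1 0 * (moebius d / (real d)\<^sup>2)"
      by (simp add: R_def distrib_left)
  qed
  also have "\<dots> = (\<Sum>d=1..X. Q * (moebius d / real d) * R d) - Q\<^sup>2 * F1 0 * (\<Sum>d=1..X. moebius d / (real d)\<^sup>2)"
    by (simp add: sum_subtractf sum_distrib_left)
  finally have "\<bar>(\<Sum>q=1..X. real (totient q) * w (real q / Q)) + Q\<^sup>2 * F1 0 * (\<Sum>d=1..X. moebius d / (real d)\<^sup>2)\<bar>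
      = \<bar>\<Sum>d=1..X. Q * (moebius d / real d) * R d\<bar>" by simp
  also have "\<dots> \<le> (\<Sum>d=1..X. Q * (1 / real d) * (4 * k1))"
  proof (rule order_trans[OF sum_abs sum_mono])
    fix d assume "d \<in> {1..X}"
    then have "\<bar>Q * (moebius d / real d)\<bar> * \<bar>R d\<bar> \<le> Q * (1 / real d) * (4 * k1)"
      using assms(3) R[of d] abs_moebius_le_1[of d]
      by (intro mult_mono) (auto simp: abs_mult divide_right_mono)
    then show "\<bar>Q * (moebius d / real d) * R d\<bar> \<le> Q * (1 / real d) * (4 * k1)" by (simp only: abs_mult)
  qed
  also have "\<dots> = 4 * k1 * Q * (\<Sum>d=1..X. 1 / real d)"
    by (simp add: sum_distrib_left mult_ac)
  finally show ?thesis .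
qed

section \<open>Sequences with prescribed divisor sums\<close>

text \<open>
  A large sieve inequality on average, read off from the divisor sums alone: in the sum of
  \<open>r * s \<le> 2 * N * s\<close> over the \<open>N\<close> values \<open>r\<close> in \<open>[N, 2N)\<close>, each \<open>A q\<close> with \<open>q \<le> N\<close> is counted
  at least \<open>\<lfloor>N/q\<rfloor> \<ge> N/(2q)\<close> times.
\<close>

lemma sum_over_modulus_le:
  fixes A :: "nat \<Rightarrow> real"
  assumes "N \<ge> 1" "\<And>q. A q \<ge> 0" "s \<ge> 0" "\<And>r. r \<ge> N \<Longrightarrow> (\<Sum>q | q dvd r. A q) = real r * s"
  shows "(\<Sum>q=1..N. A q / real q) \<le> 4 * real N * s"
proof -
  have cnt: "real N / (2 * real q) \<le> real (card {r\<in>{N..<2*N}. q dvd r})" if q: "q \<in> {1..N}" for q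
  proof -
    \<comment> \<open>the image of \<open>j\<close> is the \<open>j\<close>-th multiple of \<open>q\<close> beyond \<open>N - 1\<close>\<close>
    have "inj_on (\<lambda>j. q * ((N - 1) div q + j)) {1..N div q}" using q by (auto simp: inj_on_def)
    moreover have "(\<lambda>j. q * ((N - 1) div q + j)) ` {1..N div q} \<subseteq> {r\<in>{N..<2*N}. q dvd r}"
    proof safe
      fix j assume j: "j \<in> {1..N div q}"
      have m: "q * ((N - 1) div q) + (N - 1) mod q = N - 1" by simp
      have "(N - 1) mod q < q" using q by simp
      moreover have "q \<le> q * j" using j by simp
      ultimately have "N - 1 < q * ((N - 1) div q) + q * j" using m by linarith
      then show "q * ((N - 1) div q + j) \<in> {N..<2*N}"
      proof -
        assume lo: "N - 1 < q * ((N - 1) div q) + q * j"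
        have "q * j \<le> q * (N div q)" using j by (intro mult_le_mono) auto
        also have "\<dots> \<le> N" by simp
        finally have "q * ((N - 1) div q) + q * j \<le> N - 1 + N" using m by linarith
        then have "N \<le> q * ((N - 1) div q) + q * j \<and> q * ((N - 1) div q) + q * j < 2 * N"
          using lo assms(1) by linarith
        then show ?thesis by (simp add: distrib_left)
      qed
    qed auto
    ultimately have "card {1..N div q} \<le> card {r\<in>{N..<2*N}. q dvd r}"
      by (intro card_inj_on_le) auto
    moreover have "N \<le> 2 * q * (N div q)"
    proof -
      have "N div q \<ge> 1" using q by (simp add: Suc_le_eq div_greater_zero_iff)
      then have "q * 1 \<le> q * (N div q)" by (intro mult_le_mono) auto
      moreover have "q * (N div q) + N mod q = N" "N mod q < q" using q by simp_all
      ultimately show ?thesis by linarith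
    qed
    then have "real N \<le> 2 * real q * real (N div q)"
      by (metis of_nat_le_iff of_nat_mult of_nat_numeral)
    then have "real N / (2 * real q) \<le> real (N div q)" using q by (simp add: field_simps)
    ultimately show ?thesis by simp
  qed
  have "real N / 2 * (\<Sum>q=1..N. A q / real q) = (\<Sum>q=1..N. real N / (2 * real q) * A q)"
    by (simp add: sum_distrib_left field_simps)
  also have "\<dots> \<le> (\<Sum>q=1..N. real (card {r\<in>{N..<2*N}. q dvd r}) * A q)"
    using cnt assms(2) by (intro sum_mono mult_right_mono) auto
  also have "\<dots> = (\<Sum>q=1..N. \<Sum>r\<in>{N..<2*N}. if q dvd r then A q else 0)"
    by (intro sum.cong refl) (simp add: sum.If_cases Int_def)
  also have "\<dots> = (\<Sum>r\<in>{N..<2*N}. \<Sum>q=1..N. if q dvd r then A q else 0)"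
    by (rule sum.swap)
  also have "\<dots> \<le> (\<Sum>r\<in>{N..<2*N}. \<Sum>q | q dvd r. A q)"
  proof (rule sum_mono)
    fix r assume r: "r \<in> {N..<2*N}"
    have "(\<Sum>q=1..N. if q dvd r then A q else 0) = (\<Sum>q\<in>{q\<in>{1..N}. q dvd r}. A q)"
      by (simp add: sum.If_cases Int_def)
    also have "\<dots> \<le> (\<Sum>q | q dvd r. A q)"
      by (rule sum_mono2) (use r assms in auto)
    finally show "(\<Sum>q=1..N. if q dvd r then A q else 0) \<le> \<dots>" .
  qed
  also have "\<dots> \<le> (\<Sum>r\<in>{N..<2*N}. 2 * real N * s)"
    using assms by (intro sum_mono) (auto intro!: mult_right_mono)
  also have "\<dots> = real N / 2 * (4 * real N * s)" by simp
  finally show ?thesis using assms(1) by (simp add: mult_ac)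
qed

section \<open>Exponential sums over Farey fractions\<close>

text \<open>
  Reducing to lowest terms is a bijection between the \<open>a/r\<close> with \<open>1 \<le> a \<le> r\<close> and the
  fractions \<open>b/q\<close> in lowest terms in \<open>(0, 1]\<close> with \<open>q dvd r\<close>.
\<close>

lemma sum_fractions_reduced:
  fixes f :: "real \<Rightarrow> real"
  assumes "r \<ge> 1"
  shows "(\<Sum>q | q dvd r. \<Sum>b\<in>totatives q. f (real b / real q)) = (\<Sum>a=1..r. f (real a / real r))"
proof -
  have "(\<Sum>q | q dvd r. \<Sum>b\<in>totatives q. f (real b / real q))
      = (\<Sum>(q,b)\<in>(SIGMA q:{q. q dvd r}. totatives q). f (real b / real q))"
    using assms by (intro sum.Sigma) auto
  also have "\<dots> = (\<Sum>a=1..r. f (real a / real r))"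
  proof (rule sum.reindex_bij_witness[of _ "\<lambda>a. (r div gcd a r, a div gcd a r)" "\<lambda>(q,b). b * (r div q)"])
    fix x assume x: "x \<in> (SIGMA q:{q. q dvd r}. totatives q)"
    then obtain q b where qb: "x = (q, b)" "q dvd r" "0 < b" "b \<le> q" "coprime b q"
      by (auto simp: in_totatives_iff)
    then obtain c where c: "r = q * c" by auto
    have pos: "q > 0" "c > 0" using c assms by (auto intro!: Nat.gr0I)
    have "gcd (b * c) (q * c) = gcd b q * c" by (simp add: gcd_mult_distrib_nat mult.commute)
    then have g: "gcd (b * c) (q * c) = c" using qb by simp
    show "(\<lambda>a. (r div gcd a r, a div gcd a r)) ((\<lambda>(q,b). b * (r div q)) x) = x"
      using qb(1) c pos g by simp
    show "(\<lambda>(q,b). b * (r div q)) x \<in> {1..r}"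
      using qb c pos by (auto simp: Suc_le_eq)
    show "f (real ((\<lambda>(q,b). b * (r div q)) x) / real r) = (case x of (q, b) \<Rightarrow> f (real b / real q))"
      using qb(1) c pos by simp
  next
    fix a assume a: "a \<in> {1..r}"
    have g: "gcd a r > 0" using a by simp
    have ga: "gcd a r dvd a" "gcd a r dvd r" by auto
    have r: "r = r div gcd a r * gcd a r" by simp
    have rg: "r div gcd a r > 0" using g ga(2) a
      by (metis assms dvd_div_eq_0_iff gr0I not_one_le_zero)
    have "r div (r div gcd a r) = gcd a r"
      using r rg by (metis nonzero_mult_div_cancel_left not_gr_zero)
    then show "(\<lambda>(q,b). b * (r div q)) (r div gcd a r, a div gcd a r) = a" by simp
    have "a div gcd a r > 0"
      using g ga(1) a by (metis atLeastAtMost_iff dvd_div_eq_0_iff gr0I not_one_le_zero)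
    moreover have "coprime (a div gcd a r) (r div gcd a r)"
      using g by (intro div_gcd_coprime) auto
    moreover have "a div gcd a r \<le> r div gcd a r" using a by (intro div_le_mono) auto
    moreover have "r div gcd a r dvd r" using r by (metis dvd_triv_left)
    ultimately show "(r div gcd a r, a div gcd a r) \<in> (SIGMA q:{q. q dvd r}. totatives q)"
      by (auto simp: in_totatives_iff)
  qed
  finally show ?thesis .
qed

lemma e_power: "e (x * real a) = e x ^ a"
  unfolding e_def by (simp add: exp_of_nat_mult[symmetric] mult_ac)

lemma e_of_nat: "e (real m) = 1"
  unfolding e_def using exp_eq_1[of "2 * of_real pi * \<i> * of_real (real m)"]
  by (auto intro!: exI[of _ "int m"])

lemma e_mult_cnj: "e x * cnj (e x) = 1"
  by (simp add: e_def exp_cnj exp_minus)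

lemma sum_additive_characters:
  assumes "m \<le> r" "n \<le> r" "m \<ge> 1" "n \<ge> 1"
  shows "(\<Sum>a=1..r. e (real m * (real a / real r)) * cnj (e (real n * (real a / real r))))
    = (if m = n then of_nat r else 0)"
proof (cases "m = n")
  case True
  then show ?thesis by (simp add: e_mult_cnj)
next
  case False
  define z where "z = e (real m / real r) * cnj (e (real n / real r))"
  have term_eq: "e (real m * (real a / real r)) * cnj (e (real n * (real a / real r))) = z ^ a" for a
    using e_power[of "real m / real r" a] e_power[of "real n / real r" a]
    by (simp add: z_def power_mult_distrib)
  have r0: "r > 0" using assms by simp
  have zr: "z ^ r = 1" using term_eq[of r] r0 by (simp add: e_of_nat)
  have z1: "z \<noteq> 1"
  proof
    assume "z = 1"
    then have "e (real m / real r) * (cnj (e (real n / real r)) * e (real n / real r)) = e (real n / real r)"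
      by (simp add: z_def mult.assoc[symmetric])
    then have "e (real m / real r) = e (real n / real r)"
      using e_mult_cnj[of "real n / real r"] by (simp add: mult.commute)
    then obtain j :: int where "2 * of_real pi * \<i> * of_real (real m / real r)
        = 2 * of_real pi * \<i> * of_real (real n / real r) + of_real (of_int (2 * j) * pi) * \<i>"
      unfolding e_def exp_eq by blast
    then have "2 * of_real pi * \<i> * of_real (real m / real r)
        = 2 * of_real pi * \<i> * of_real (real n / real r + real_of_int j)"
      by (simp add: algebra_simps)
    then have "real m / real r = real n / real r + real_of_int j"
      by (simp only: mult_cancel_left of_real_eq_iff) simp
    then have "real_of_int (int m) = real_of_int (int n + j * int r)"
      using r0 by (simp add: field_simps)
    then have mn: "int m - int n = j * int r" by linarith
    then have "\<bar>j\<bar> * int r < 1 * int r"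
      using assms abs_mult[of j "int r"] by linarith
    then have "j = 0" using r0 by (simp only: mult_less_cancel_right) auto
    then show False using mn False by simp
  qed
  have "(z - 1) * (\<Sum>a=1..r. z ^ a) = 0"
  proof -
    have "(z - 1) * (\<Sum>a=1..n. z ^ a) = z * (z ^ n - 1)" for n
      by (induction n) (auto simp: algebra_simps)
    then show ?thesis using zr by simp
  qed
  then show ?thesis unfolding term_eq using z1 False by simp
qed

text \<open>
  For \<open>r \<ge> N\<close> the residues of \<open>1, ..., N\<close> modulo \<open>r\<close> are distinct, so orthogonality kills every
  off-diagonal term.
\<close>

lemma sum_S_complete:
  assumes "r \<ge> N" "r \<ge> 1"
  shows "(\<Sum>a=1..r. (cmod (S N \<phi> (real a / real r)))\<^sup>2) = real r * (\<Sum>m=1..N. (cmod (\<phi> m))\<^sup>2)"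
proof -
  define E where "E m a = e (real m * (real a / real r))" for m a
  have "complex_of_real (\<Sum>a=1..r. (cmod (S N \<phi> (real a / real r)))\<^sup>2)
      = (\<Sum>a=1..r. \<Sum>m=1..N. \<Sum>n=1..N. (\<phi> m * cnj (\<phi> n)) * (E m a * cnj (E n a)))"
    unfolding of_real_sum complex_norm_square S_def E_def
    by (simp add: sum_product cnj_sum mult_ac)
  also have "\<dots> = (\<Sum>m=1..N. \<Sum>n=1..N. (\<phi> m * cnj (\<phi> n)) * (\<Sum>a=1..r. E m a * cnj (E n a)))"
    unfolding sum_distrib_left
    by (rule trans[OF sum.swap]) (intro sum.cong refl sum.swap)
  also have "\<dots> = (\<Sum>m=1..N. \<Sum>n=1..N. if m = n then of_nat r * (\<phi> m * cnj (\<phi> n)) else 0)"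
    unfolding E_def
    by (intro sum.cong refl, subst sum_additive_characters) (use assms in auto)
  also have "\<dots> = complex_of_real (real r * (\<Sum>m=1..N. (cmod (\<phi> m))\<^sup>2))"
    by (simp add: sum_distrib_left complex_norm_square[symmetric] del: complex_mult_cnj)
  finally show ?thesis by (simp only: of_real_eq_iff)
qed

section \<open>The profile of a weight\<close>

text \<open>
  The extension is \<open>g\<close> composed with the nearest-point projection to \<open>[1, 2]\<close>, which is
  \<open>1\<close>-Lipschitz.
\<close>

lemma lipschitz_extend_by_zero:
  fixes g D :: "real \<Rightarrow> real"
  assumes deriv: "\<And>x. x \<in> {1..2} \<Longrightarrow> (g has_real_derivative D x) (at x within {1..2})"
    and cont: "continuous_on {1..2} D" and "g 1 = 0" "g 2 = 0"
  shows "\<exists>k. \<forall>x y. \<bar>(if x \<in> {1..2} then g x else 0) - (if y \<in> {1..2} then g y else 0)\<bar> \<le> k * \<bar>x - y\<bar>"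
proof -
  have "bounded (D ` {1..2})"
    using cont compact_continuous_image compact_imp_bounded by blast
  then have "\<exists>k. \<forall>x\<in>{1..2}. norm (D x) \<le> k" by (auto simp: bounded_iff)
  then obtain k where k: "\<And>x. x \<in> {1..2} \<Longrightarrow> norm (D x) \<le> k" by blast
  define c where "c x = max 1 (min 2 x)" for x :: real
  have c: "c x \<in> {1..2}" for x by (auto simp: c_def)
  have g: "(if x \<in> {1..2} then g x else 0) = g (c x)" for x
    using assms(3,4) by (auto simp: c_def max_def min_def)
  have "0 \<le> k" using k[of 1] norm_ge_zero[of "D 1"] by simp
  have "\<bar>g (c x) - g (c y)\<bar> \<le> k * \<bar>x - y\<bar>" for x y
  proof -
    have "norm (g (c x) - g (c y)) \<le> k * norm (c x - c y)"
      by (rule field_differentiable_bound[of "{1..2}" g D]) (use deriv k c in auto)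
    also have "\<dots> \<le> k * \<bar>x - y\<bar>"
      using \<open>0 \<le> k\<close> by (intro mult_left_mono) (auto simp: c_def max_def min_def)
    finally show ?thesis by simp
  qed
  then have "\<forall>x y. \<bar>g (c x) - g (c y)\<bar> \<le> k * \<bar>x - y\<bar>" by simp
  then show ?thesis unfolding g by (rule exI)
qed

lemma lipschitz_cutoff_exists:
  fixes w :: "real \<Rightarrow> real"
  assumes lip: "\<And>x y. \<bar>w x - w y\<bar> \<le> k * \<bar>x - y\<bar>" and "\<And>x. x \<ge> 2 \<Longrightarrow> w x = 0"
  shows "\<exists>F. lipschitz_cutoff w F k"
proof -
  have "0 \<le> k" using lip[of 0 1] by simp
  then have "k-lipschitz_on UNIV w" using lip by (intro lipschitz_onI) (auto simp: dist_real_def)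
  then have "continuous_on UNIV w" by (rule lipschitz_on_continuous_on)
  then obtain F where "\<forall>x. (F has_real_derivative w x) (at x)" "\<forall>x\<ge>2. F x = 0"
    using continuous_antiderivative[of w 2, OF _ assms(2)] by auto
  then have "lipschitz_cutoff w F k" by unfold_locales (use lip assms(2) in auto)
  then show ?thesis by blast
qed

text \<open>
  The support condition allows \<open>1\<close> and \<open>2\<close> to lie in the support; that \<open>W\<close> vanishes there is
  continuity.
\<close>

lemma weight_vanishes:
  assumes "weight W" "0 \<le> u" "u \<le> 1 \<or> u \<ge> 2"
  shows "W u = 0"
proof -
  obtain D :: "nat \<Rightarrow> real \<Rightarrow> real" where D: "\<And>x. D 0 x = W x" "continuous_on UNIV (D 0)"
    using assms(1) by (auto simp: weight_def Ck_on_def)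
  then have "D 0 = W" by auto
  then have "closed {x. W x = 0}"
    using D(2) by (intro closed_Collect_eq) auto
  moreover have "W x = 0" if "x \<notin> {-2..-1} \<union> {1..2}" for x
    using assms(1) that closure_subset[of "{u. W u \<noteq> 0}"] by (auto simp: weight_def)
  then have "{-1<..<1} \<union> {2<..} \<subseteq> {x. W x = 0}" by auto
  ultimately have "closure ({-1<..<1} \<union> {2<..}) \<subseteq> {x. W x = 0}" by (rule closure_minimal[rotated])
  then have "{-1..1} \<union> {2..} \<subseteq> {x. W x = 0}" by (simp add: closure_Un)
  moreover have "u \<in> {-1..1} \<union> {2..}" using assms(2,3) by auto
  ultimately show ?thesis by blast
qed

lemma weight_lipschitz:
  assumes "weight W"
  shows "\<exists>k. \<forall>x y. \<bar>(if x \<in> {1..2} then W x else 0) - (if y \<in> {1..2} then W y else 0)\<bar> \<le> k * \<bar>x - y\<bar>"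
    and "\<exists>k. \<forall>x y. \<bar>(if x \<in> {1..2} then W x / x else 0) - (if y \<in> {1..2} then W y / y else 0)\<bar> \<le> k * \<bar>x - y\<bar>"
proof -
  from assms have "Ck_on 3 UNIV W" by (simp add: weight_def)
  then obtain D :: "nat \<Rightarrow> real \<Rightarrow> real" where "\<forall>x. D 0 x = W x"
    "\<forall>j<3. \<forall>x. (D j has_real_derivative D (Suc j) x) (at x)" "\<forall>j\<le>3. continuous_on UNIV (D j)"
    unfolding Ck_on_def by auto
  then have D: "\<And>x. D 0 x = W x"
    "\<And>x j. j < 3 \<Longrightarrow> (D j has_real_derivative D (Suc j) x) (at x)" "\<And>j. j \<le> 3 \<Longrightarrow> continuous_on UNIV (D j)"
    by auto
  have D0: "D 0 = W" using D(1) by auto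
  have W': "(W has_real_derivative D 1 x) (at x)" for x using D(2)[of 0 x] D0 by simp
  have c1: "continuous_on {1..2} (D 1)" "continuous_on {1..2} W"
    using D(3)[of 1] D(3)[of 0] D0 continuous_on_subset by auto
  have W12: "W 1 = 0" "W 2 = 0" using weight_vanishes[OF assms] by auto
  show "\<exists>k. \<forall>x y. \<bar>(if x \<in> {1..2} then W x else 0) - (if y \<in> {1..2} then W y else 0)\<bar> \<le> k * \<bar>x - y\<bar>"
    by (rule lipschitz_extend_by_zero[of W "D 1", OF has_field_derivative_at_within[OF W'] c1(1) W12])
  have d2: "((\<lambda>x. W x / x) has_real_derivative (D 1 x * x - W x) / (x * x)) (at x within {1..2})"
    if "x \<in> {1..2}" for x
    using that DERIV_divide[OF has_field_derivative_at_within[OF W'] DERIV_ident, of x "{1..2}"] by simp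
  have c2: "continuous_on {1..2} (\<lambda>x. (D 1 x * x - W x) / (x * x))"
    using c1 by (intro continuous_intros) auto
  show "\<exists>k. \<forall>x y. \<bar>(if x \<in> {1..2} then W x / x else 0) - (if y \<in> {1..2} then W y / y else 0)\<bar> \<le> k * \<bar>x - y\<bar>"
    by (rule lipschitz_extend_by_zero[of "\<lambda>x. W x / x", OF d2 c2]) (use W12 in auto)
qed

text \<open>
  Dividing by \<open>u\<close> turns \<open>W (q/Q) / (q * Q)\<close> into \<open>profile W (q/Q) / Q\<^sup>2\<close>. The mirror image of
  the support on the negative axis is dropped, so that the function vanishes outside \<open>[1, 2]\<close>.
\<close>

definition profile :: "(real \<Rightarrow> real) \<Rightarrow> real \<Rightarrow> real" where
  "profile W x = (if x \<in> {1..2} then W x / x else 0)"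

lemma infsum_weight:
  assumes "weight W" "Q > 0" "real X \<ge> 2 * Q"
  shows "(\<Sum>\<^sub>\<infinity>q\<in>{1::nat..}. W (real q / Q) / (real q * Q) * a q)
    = (\<Sum>q=1..X. a q * profile W (real q / Q)) / Q\<^sup>2"
proof -
  have pr: "W (real q / Q) / (real q * Q) = profile W (real q / Q) / Q\<^sup>2" if "q \<ge> 1" for q
  proof (cases "real q / Q \<in> {1..2}")
    case True
    then have "profile W (real q / Q) = W (real q / Q) / (real q / Q)" by (simp only: profile_def if_True)
    then show ?thesis using assms(2) by (simp add: power2_eq_square)
  next
    case False
    then have "W (real q / Q) = 0"
      using assms by (intro weight_vanishes) auto
    moreover have "profile W (real q / Q) = 0" using False by (simp only: profile_def if_False)
    ultimately show ?thesis by simp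
  qed
  have "(\<Sum>\<^sub>\<infinity>q\<in>{1::nat..}. W (real q / Q) / (real q * Q) * a q)
      = (\<Sum>\<^sub>\<infinity>q\<in>{1..X}. a q * profile W (real q / Q) / Q\<^sup>2)"
  proof (rule infsum_cong_neutral)
    fix q assume "q \<in> {1..} - {1..X}"
    then have "real q / Q \<ge> 2" using assms by (auto simp: field_simps)
    then show "W (real q / Q) / (real q * Q) * a q = 0"
      using weight_vanishes[OF assms(1), of "real q / Q"] by simp
  qed (use pr in auto)
  then show ?thesis by (simp add: sum_divide_distrib)
qed

text \<open>
  Here \<open>F1 0\<close> is minus the integral of \<open>W\<close> over the positive axis; this is where the
  nonvanishing of that integral enters.
\<close>

lemma weight_cutoffs:
  assumes "weight W"
  obtains F k F1 k1 where "lipschitz_cutoff (profile W) F k"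
    "lipschitz_cutoff (\<lambda>x. x * profile W x) F1 k1" "F1 0 \<noteq> 0"
proof -
  obtain k1 k where k:
    "\<And>x y. \<bar>(if x \<in> {1..2} then W x else 0) - (if y \<in> {1..2} then W y else 0)\<bar> \<le> k1 * \<bar>x - y\<bar>"
    "\<And>x y. \<bar>(if x \<in> {1..2} then W x / x else 0) - (if y \<in> {1..2} then W y / y else 0)\<bar> \<le> k * \<bar>x - y\<bar>"
    using weight_lipschitz[OF assms] by meson
  have W0: "W 2 = 0" using weight_vanishes[OF assms, of 2] by simp
  have xp: "x * profile W x = (if x \<in> {1..2} then W x else 0)" for x
    by (simp add: profile_def)
  have p2: "profile W x = 0" if "x \<ge> 2" for x using that W0 by (auto simp: profile_def)
  obtain F where F: "lipschitz_cutoff (profile W) F k"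
    using lipschitz_cutoff_exists[of "profile W" k, OF _ p2] k(2) unfolding profile_def by meson
  obtain F1 where F1: "lipschitz_cutoff (\<lambda>x. x * profile W x) F1 k1"
    using lipschitz_cutoff_exists[of "\<lambda>x. x * profile W x" k1] k(1) p2 unfolding xp[symmetric] by fastforce
  interpret W: lipschitz_cutoff "\<lambda>x. x * profile W x" F1 k1 by fact
  have "((\<lambda>x. x * profile W x) has_integral (F1 2 - F1 0)) {0..2}"
    using W.deriv by (intro fundamental_theorem_of_calculus)
      (auto simp: has_real_derivative_iff_has_vector_derivative[symmetric] has_field_derivative_at_within)
  then have "((\<lambda>x. x * profile W x) has_integral (F1 2 - F1 0)) {0..}"
    by (rule has_integral_on_superset) (auto simp: profile_def)
  then have "(W has_integral (F1 2 - F1 0)) {0..}"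
    by (rule has_integral_eq[rotated]) (use weight_vanishes[OF assms] in \<open>auto simp: xp\<close>)
  then have "integral {0..} W = - F1 0" using W.F_beyond[of 2] by (simp add: integral_unique)
  then have "F1 0 \<noteq> 0" using assms by (auto simp: weight_def)
  then show ?thesis using that F F1 by blast
qed

text \<open>
  The main term of \<open>I0 W Q\<close> is at least \<open>|F1 0|/4\<close> in absolute value by
  \<open>sum_moebius_squares_ge\<close>. The threshold for \<open>Q\<close> is chosen so that the error
  \<open>16 * k1 / \<surd>Q\<close> takes away at most half of this.
\<close>

lemma I0_lower_bound:
  assumes "weight W" "lipschitz_cutoff (profile W) F k"
    "lipschitz_cutoff (\<lambda>x. x * profile W x) F1 k1" "F1 0 \<noteq> 0"
    and Q: "Q \<ge> 1" "Q \<ge> (128 * k1 / \<bar>F1 0\<bar>)\<^sup>2"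
  shows "\<bar>I0 W Q\<bar> \<ge> \<bar>F1 0\<bar> / 8"
proof -
  interpret W: lipschitz_cutoff "\<lambda>x. x * profile W x" F1 k1 by fact
  define X where "X = nat \<lceil>2 * Q\<rceil>"
  have X: "real X \<ge> 2 * Q" "real X \<le> 4 * Q" "X \<ge> 1"
    unfolding X_def using Q(1) by linarith+
  define T where "T = (\<Sum>q=1..X. real (totient q) * profile W (real q / Q))"
  define m where "m = (\<Sum>d=1..X. moebius d / (real d)\<^sup>2)"
  have I0: "I0 W Q = T / Q\<^sup>2"
    using infsum_weight[OF assms(1) _ X(1), of "\<lambda>q. real (totient q)"] Q(1)
    by (simp add: I0_def T_def mult.commute)
  have "\<bar>T + Q\<^sup>2 * F1 0 * m\<bar> \<le> 4 * k1 * Q * (\<Sum>d=1..X. 1 / real d)"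
    unfolding T_def m_def by (rule sum_totient_weighted[OF assms(2,3)]) (use Q X in auto)
  also have "\<dots> \<le> 4 * k1 * Q * (4 * sqrt Q)"
  proof (rule mult_left_mono)
    have "sqrt (real X) \<le> sqrt (4 * Q)" using X by simp
    then have "sqrt (real X) \<le> 2 * sqrt Q" by (simp add: real_sqrt_mult)
    then show "(\<Sum>d=1..X. 1 / real d) \<le> 4 * sqrt Q" using sum_inverse_le_sqrt[of X] by linarith
    show "0 \<le> 4 * k1 * Q" using W.k_nonneg Q by simp
  qed
  also have "\<dots> \<le> Q\<^sup>2 * (\<bar>F1 0\<bar> / 8)"
  proof -
    have "128 * k1 / \<bar>F1 0\<bar> \<le> sqrt Q" using Q(2) by (rule real_le_rsqrt)
    then have "16 * k1 \<le> sqrt Q * (\<bar>F1 0\<bar> / 8)" using assms(4) by (simp add: field_simps)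
    then have "16 * k1 * (Q * sqrt Q) \<le> sqrt Q * (\<bar>F1 0\<bar> / 8) * (Q * sqrt Q)"
      using Q(1) by (intro mult_right_mono) auto
    also have "\<dots> = (sqrt Q * sqrt Q) * Q * (\<bar>F1 0\<bar> / 8)" by (simp only: mult_ac)
    also have "\<dots> = Q\<^sup>2 * (\<bar>F1 0\<bar> / 8)" using Q(1) by (simp add: power2_eq_square)
    finally show ?thesis by (simp add: mult_ac)
  qed
  finally have err: "\<bar>T + Q\<^sup>2 * F1 0 * m\<bar> \<le> Q\<^sup>2 * (\<bar>F1 0\<bar> / 8)" .
  have m: "m \<ge> 1 / 4" unfolding m_def by (rule sum_moebius_squares_ge[OF X(3)])
  have "Q\<^sup>2 * \<bar>F1 0\<bar> * (1 / 4) \<le> Q\<^sup>2 * \<bar>F1 0\<bar> * m"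
    using m by (intro mult_left_mono) auto
  also have "\<dots> = \<bar>Q\<^sup>2 * F1 0 * m\<bar>" using m by (simp add: abs_mult)
  finally have "\<bar>T\<bar> \<ge> Q\<^sup>2 * (\<bar>F1 0\<bar> / 8)" using err by linarith
  then show ?thesis using Q(1) unfolding I0 by (simp add: pos_le_divide_eq mult.commute)
qed

section \<open>The quadratic form over Farey fractions\<close>

text \<open>
  The constant is \<open>12 * k\<close> from \<open>sum_weighted_bound\<close> times \<open>5\<close>, since the sum of \<open>|c q| / q\<close>
  over \<open>q \<le> N\<close> is at most \<open>4 * N * s\<close> from \<open>A\<close> plus \<open>N * s\<close> from the totients.
\<close>

lemma farey_quadratic_form:
  assumes "weight W" "lipschitz_cutoff (profile W) F k" "Q > 0" "N \<ge> 1"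
  shows "\<bar>(\<Sum>\<^sub>\<infinity>q\<in>{1::nat..}. W (real q / Q) / (real q * Q) *
            (\<Sum>a\<in>totatives q. (cmod (S N \<phi> (real a / real q)))\<^sup>2))
          - I0 W Q * (\<Sum>m=1..N. (cmod (\<phi> m))\<^sup>2)\<bar>
    \<le> 60 * k * (real N / Q) * (\<Sum>m=1..N. (cmod (\<phi> m))\<^sup>2)"
proof -
  interpret w: lipschitz_cutoff "profile W" F k by fact
  define X where "X = nat \<lceil>2 * Q\<rceil>"
  have X: "real X \<ge> 2 * Q" unfolding X_def by linarith
  define s where "s = (\<Sum>m=1..N. (cmod (\<phi> m))\<^sup>2)"
  have s0: "s \<ge> 0" by (simp add: s_def sum_nonneg)
  define A where "A q = (\<Sum>a\<in>totatives q. (cmod (S N \<phi> (real a / real q)))\<^sup>2)" for q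
  have A0: "A q \<ge> 0" for q by (simp add: A_def sum_nonneg)
  define c where "c q = A q - real (totient q) * s" for q
  have A_div: "(\<Sum>q | q dvd r. A q) = real r * s" if "r \<ge> N" for r
    unfolding A_def s_def
    using that assms(4) sum_S_complete[of N r \<phi>]
      sum_fractions_reduced[of r "\<lambda>x. (cmod (S N \<phi> x))\<^sup>2"] by simp
  have c_div: "(\<Sum>q | q dvd r. c q) = 0" if "r \<ge> N" for r
    using A_div[OF that] sum_totient_divisors[of r]
    by (simp add: c_def sum_subtractf sum_distrib_right[symmetric])
  have "(\<Sum>q=1..N. \<bar>c q\<bar> / real q) \<le> (\<Sum>q=1..N. A q / real q + s)"
  proof (rule sum_mono)
    fix q assume q: "q \<in> {1..N}"
    have "real (totient q) * s \<le> real q * s" using s0 totient_le[of q] by (intro mult_right_mono) auto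
    moreover have "0 \<le> real (totient q) * s" using s0 by simp
    ultimately have "\<bar>c q\<bar> \<le> A q + real q * s" using A0[of q] unfolding c_def by linarith
    then have "\<bar>c q\<bar> / real q \<le> (A q + real q * s) / real q" by (intro divide_right_mono) auto
    then show "\<bar>c q\<bar> / real q \<le> A q / real q + s" using q by (simp add: add_divide_distrib)
  qed
  also have "\<dots> = (\<Sum>q=1..N. A q / real q) + real N * s" by (simp add: sum.distrib)
  also have "\<dots> \<le> 5 * real N * s"
    using sum_over_modulus_le[of N A s, OF assms(4) A0 s0 A_div] by linarith
  finally have cN: "(\<Sum>q=1..N. \<bar>c q\<bar> / real q) \<le> 5 * real N * s" .
  have "\<bar>\<Sum>q=1..X. c q * profile W (real q / Q)\<bar> \<le> 12 * k * Q * (\<Sum>q=1..N. \<bar>c q\<bar> / real q)"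
    using w.sum_weighted_bound[OF assms(3) X assms(4) c_div] by simp
  also have "\<dots> \<le> 12 * k * Q * (5 * real N * s)"
    using cN w.k_nonneg assms(3) by (intro mult_left_mono) auto
  finally have "\<bar>\<Sum>q=1..X. c q * profile W (real q / Q)\<bar> / Q\<^sup>2 \<le> 12 * k * Q * (5 * real N * s) / Q\<^sup>2"
    by (rule divide_right_mono) simp
  also have "\<dots> = 60 * k * (real N / Q) * s" using assms(3) by (simp add: power2_eq_square)
  finally have bound: "\<bar>(\<Sum>q=1..X. c q * profile W (real q / Q)) / Q\<^sup>2\<bar> \<le> 60 * k * (real N / Q) * s"
    by simp
  have I0: "I0 W Q = (\<Sum>q=1..X. real (totient q) * profile W (real q / Q)) / Q\<^sup>2"
    using infsum_weight[OF assms(1,3) X, of "\<lambda>q. real (totient q)"]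
    by (simp add: I0_def mult.commute)
  have "(\<Sum>q=1..X. c q * profile W (real q / Q))
      = (\<Sum>q=1..X. A q * profile W (real q / Q)) - s * (\<Sum>q=1..X. real (totient q) * profile W (real q / Q))"
    unfolding c_def left_diff_distrib sum_subtractf sum_distrib_left by (simp only: mult_ac)
  then have "(\<Sum>\<^sub>\<infinity>q\<in>{1::nat..}. W (real q / Q) / (real q * Q) * A q) - I0 W Q * s
      = (\<Sum>q=1..X. c q * profile W (real q / Q)) / Q\<^sup>2"
    unfolding infsum_weight[OF assms(1,3) X] I0 by (simp add: diff_divide_distrib mult.commute)
  then show ?thesis using bound unfolding A_def s_def by simp
qed

theorem corollary1p4:
  fixes W :: "real \<Rightarrow> real"
  assumes "weight W"
  shows "\<exists>Q0\<ge>1. \<forall>A::real. \<exists>C::real. \<forall>N::nat. \<forall>Q::real.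
           N \<ge> 1 \<longrightarrow> Q \<ge> Q0 \<longrightarrow> ln Q \<le> A * ln (real N) \<longrightarrow>
           (\<forall>\<phi> :: nat \<Rightarrow> complex. \<exists>\<theta>::real.
              \<bar>\<theta>\<bar> \<le> C * (real N / Q) \<and>
              (\<Sum>\<^sub>\<infinity>q\<in>{1::nat..}. W (real q / Q) / (real q * Q) *
                 (\<Sum>a\<in>totatives q. (cmod (S N \<phi> (real a / real q)))\<^sup>2))
              = (1 + \<theta>) * I0 W Q * (\<Sum>m=1..N. (cmod (\<phi> m))\<^sup>2))"
proof -
  obtain F k F1 k1 where cutoffs: "lipschitz_cutoff (profile W) F k"
    "lipschitz_cutoff (\<lambda>x. x * profile W x) F1 k1" and F1: "F1 0 \<noteq> 0"
    using weight_cutoffs[OF assms] by blast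
  define Q0 where "Q0 = max 1 ((128 * k1 / \<bar>F1 0\<bar>)\<^sup>2)"
  define C where "C = 60 * k / (\<bar>F1 0\<bar> / 8)"
  have main: "\<exists>\<theta>::real. \<bar>\<theta>\<bar> \<le> C * (real N / Q) \<and>
              (\<Sum>\<^sub>\<infinity>q\<in>{1::nat..}. W (real q / Q) / (real q * Q) *
                 (\<Sum>a\<in>totatives q. (cmod (S N \<phi> (real a / real q)))\<^sup>2))
              = (1 + \<theta>) * I0 W Q * (\<Sum>m=1..N. (cmod (\<phi> m))\<^sup>2)"
    (is "\<exists>\<theta>. _ \<and> ?L = _ * _ * ?s") if NQ: "N \<ge> 1" "Q \<ge> Q0" for N Q and \<phi> :: "nat \<Rightarrow> complex"
  proof -
    have Q: "Q \<ge> 1" "Q \<ge> (128 * k1 / \<bar>F1 0\<bar>)\<^sup>2" using NQ(2) by (auto simp: Q0_def)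
    have k: "k \<ge> 0" using cutoffs(1) by (rule lipschitz_cutoff.k_nonneg)
    have I: "\<bar>I0 W Q\<bar> \<ge> \<bar>F1 0\<bar> / 8" by (rule I0_lower_bound[OF assms cutoffs F1 Q])
    have I_pos: "\<bar>I0 W Q\<bar> > 0" using I F1 by linarith
    have L: "\<bar>?L - I0 W Q * ?s\<bar> \<le> 60 * k * (real N / Q) * ?s"
      by (rule farey_quadratic_form[OF assms cutoffs(1)]) (use Q NQ in auto)
    have C: "C * (real N / Q) \<ge> 0" using k Q(1) by (simp add: C_def)
    \<comment> \<open>for \<open>?s = 0\<close> the bound on the difference makes both sides vanish, and \<open>\<theta> = 0\<close> serves\<close>
    show ?thesis
    proof (cases "?s = 0")
      case True
      then have "?L = 0" using L by simp
      then show ?thesis using True C by (intro exI[of _ 0]) simp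
    next
      case False
      then have s: "?s > 0" by (simp add: sum_nonneg order_less_le)
      define \<theta> where "\<theta> = (?L - I0 W Q * ?s) / (I0 W Q * ?s)"
      have "\<bar>\<theta>\<bar> = \<bar>?L - I0 W Q * ?s\<bar> / (\<bar>I0 W Q\<bar> * ?s)"
        using s by (simp add: \<theta>_def abs_mult)
      also have "\<dots> \<le> 60 * k * (real N / Q) * ?s / (\<bar>I0 W Q\<bar> * ?s)"
        using L I_pos s by (intro divide_right_mono) auto
      also have "\<dots> = 60 * k * (real N / Q) / \<bar>I0 W Q\<bar>" using s by simp
      also have "\<dots> \<le> 60 * k * (real N / Q) / (\<bar>F1 0\<bar> / 8)"
        using F1 k Q(1) I_pos by (intro divide_left_mono I mult_pos_pos) auto
      also have "\<dots> = C * (real N / Q)" by (simp add: C_def mult_ac)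
      finally have "\<bar>\<theta>\<bar> \<le> C * (real N / Q)" .
      moreover have "(1 + \<theta>) * I0 W Q * ?s = ?L"
        using I_pos s by (simp add: \<theta>_def field_simps)
      ultimately show ?thesis by (intro exI[of _ \<theta>]) simp
    qed
  qed
  have Q0_ge: "Q0 \<ge> 1" by (simp add: Q0_def)
  show ?thesis
    by (rule exI[of _ Q0], rule conjI[OF Q0_ge], rule allI, rule exI[of _ C], intro allI impI, rule main)
qed

end
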